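(* Let $p,q$ be positive integers and let $\kappa(z)=\frac{z}{(1-z)^2}$, $z\in\Delta$, be the Koebe function. Then $$\|S_\kappa^{[p,q]}\|_{\mathcal{B}_{p+q}}=(p+q-1)!.$$ In particular, when $p=q$, the Koebe function attains equality in the inequality $\|S_f^{[p,q]}\|_{\mathcal{B}_{p+q}}\le\sqrt{(2p-1)!(2q-1)!}$ $(f\in\mathcal{S})$, that is, $\|S_\kappa^{[p,p]}\|_{\mathcal{B}_{2p}}=(2p-1)!$.
   Context: $\Delta=\{z\in\mathbb{C}:|z|<1\}$ is the unit disk. For $\gamma\in\mathbb{R}$ and $\phi$ analytic in $\Delta$, $\|\phi\|_{\mathcal{B}_\gamma}:=\sup_{z\in\Delta}|\phi(z)|(1-|z|^2)^\gamma$. $\mathcal{S}$ is the class of univalent (injective analytic) functions $f$ in $\Delta$ with $f(0)=0$, $f'(0)=1$. For $f\in\mathcal{S}$ define $F$ on $\Delta^2$ by $F(z,w)=\log\left(\frac{f(z)-f(w)}{z-w}\cdot\frac{z}{f(z)}\cdot\frac{w}{f(w)}\right)$ if $z\ne w$, and $F(z,z)=\log\left(f'(z)\frac{z^2}{[f(z)]^2}\right)$, where $z/f(z)$ is taken to be $1$ at $z=0$ and the logarithm is the analytic branch on $\Delta^2$ with $F(0,0)=0$. For positive integers $p,q$ put $G_f^{[p,q]}(z,w)=\frac{\partial^{p+q}F}{\partial z^p\partial w^q}(z,w)$ and define the higher-order Schwarzian derivative $S_f^{[p,q]}(z)=G_f^{[p,q]}(z,z)$, $z\in\Delta$. The Koebe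 function $\kappa$ belongs to $\mathcal{S}$. *)

theory Defs
  imports "HOL-Complex_Analysis.Complex_Analysis"
begin

abbreviation unit_disk :: "complex set" where
  "unit_disk \<equiv> ball 0 1"

text \<open>The supremum may be infinite, hence the extended real values.\<close>

definition B_norm :: "real \<Rightarrow> (complex \<Rightarrow> complex) \<Rightarrow> ereal" where
  "B_norm \<gamma> \<phi> = (SUP z\<in>unit_disk. ereal (norm (\<phi> z) * (1 - (norm z)\<^sup>2) powr \<gamma>))"

definition class_S :: "(complex \<Rightarrow> complex) set" where
  "class_S = {f. f holomorphic_on unit_disk \<and> inj_on f unit_disk \<and> f 0 = 0 \<and> deriv f 0 = 1}"

definition id_over :: "(complex \<Rightarrow> complex) \<Rightarrow> complex \<Rightarrow> complex" where
  "id_over f z = (if z = 0 then 1 else z / f z)"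

definition log_arg :: "(complex \<Rightarrow> complex) \<Rightarrow> complex \<Rightarrow> complex \<Rightarrow> complex" where
  "log_arg f z w =
     (if z = w then deriv f z * (id_over f z)\<^sup>2
      else (f z - f w) / (z - w) * id_over f z * id_over f w)"

text \<open>Analyticity in two variables is complex differentiability: the Frechet derivative
  exists and is complex linear.\<close>

definition holomorphic2_on :: "(complex \<Rightarrow> complex \<Rightarrow> complex) \<Rightarrow> (complex \<times> complex) set \<Rightarrow> bool" where
  "holomorphic2_on F U \<longleftrightarrow>
     (\<forall>x\<in>U. \<exists>a b. ((\<lambda>(z, w). F z w) has_derivative (\<lambda>(h, k). a * h + b * k)) (at x within U))"

definition is_log_branch :: "(complex \<Rightarrow> complex) \<Rightarrow> (complex \<Rightarrow> complex \<Rightarrow> complex) \<Rightarrow> bool" where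
  "is_log_branch f F \<longleftrightarrow>
     holomorphic2_on F (unit_disk \<times> unit_disk) \<and>
     (\<forall>z\<in>unit_disk. \<forall>w\<in>unit_disk. exp (F z w) = log_arg f z w) \<and>
     F 0 0 = 0"

text \<open>A branch is unique on the bidisk but arbitrary off it; the choice does not
  affect derivatives at points of the (open) bidisk.\<close>

definition log_branch :: "(complex \<Rightarrow> complex) \<Rightarrow> complex \<Rightarrow> complex \<Rightarrow> complex" where
  "log_branch f = (SOME F. is_log_branch f F)"

definition G_deriv :: "(complex \<Rightarrow> complex) \<Rightarrow> nat \<Rightarrow> nat \<Rightarrow> complex \<Rightarrow> complex \<Rightarrow> complex" where
  "G_deriv f p q z w = (deriv ^^ p) (\<lambda>\<zeta>. (deriv ^^ q) (\<lambda>\<omega>. log_branch f \<zeta> \<omega>) w) z"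

definition higher_schwarzian :: "(complex \<Rightarrow> complex) \<Rightarrow> nat \<Rightarrow> nat \<Rightarrow> complex \<Rightarrow> complex" where
  "higher_schwarzian f p q z = G_deriv f p q z z"

definition koebe :: "complex \<Rightarrow> complex" where
  "koebe z = z / (1 - z)\<^sup>2"

end

theory Submission
  imports Defs
begin

text \<open>
  For the Koebe function the difference quotient collapses:
  \<open>(\<kappa> z - \<kappa> w) / (z - w) = (1 - z w) / ((1 - z)^2 (1 - w)^2)\<close>, and the factors
  \<open>z / \<kappa> z = (1 - z)^2\<close> cancel the denominator. Hence the logarithm in question is
  \<open>Ln (1 - z w)\<close>; two branches differ by a continuous function with values in the
  discrete set \<open>2 \<pi> \<i> \<int>\<close>, so the branch vanishing at the origin is unique on the
  connected bidisk (\<open>log_branch_koebe\<close>).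

  Differentiating \<open>q\<close> times in \<open>w\<close> gives \<open>- (q - 1)! z^q / (1 - z w)^q\<close>, and the Leibniz
  rule in \<open>z\<close> then gives on the diagonal (\<open>higher_schwarzian_koebe\<close>)
  \<open>S z = - (\<Sum>k. c k * z^(p + q - 2 k) / (1 - z^2)^(p + q - k))\<close> with
  \<open>c k = (p choose k) (q choose k) k! (p + q - 1 - k)! \<ge> 0\<close>.

  All summands have the same sign at points of \<open>[0, 1)\<close>, and \<open>\<bar>1 - z^2\<bar> \<ge> 1 - \<bar>z\<bar>^2\<close>, so the
  weighted modulus of \<open>S\<close> at \<open>z\<close> is at most its value at \<open>x = \<bar>z\<bar>\<close>, which is the polynomial
  \<open>\<Sum>k. c k * x^(p + q - 2 k) * (1 - x^2)^k\<close>. At \<open>x = 1\<close> only \<open>k = 0\<close> survives and the value is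
  \<open>(p + q - 1)!\<close>; this gives the lower bound by letting \<open>x\<close> tend to \<open>1\<close> along the axis.
  For the upper bound let \<open>p \<le> q\<close>. Then \<open>c k \<le> (p + q - 1)! (p choose k)\<close>, because
  \<open>q choose k \<le> (p + q - 1) choose k\<close>, and the binomial theorem bounds the sum by
  \<open>(p + q - 1)! (x^2 + (1 - x^2))^p\<close> (\<open>radial_weight_le\<close>).
\<close>

section \<open>The Koebe function and its logarithm\<close>

lemma Re_one_minus_mult_pos:
  assumes "norm (z::complex) < 1" "norm w < 1"
  shows "0 < Re (1 - z * w)"
proof -
  have "norm (z * w) < 1"
    using mult_strict_mono'[of "norm z" 1 "norm w" 1] assms by (simp add: norm_mult)
  thus ?thesis using complex_Re_le_cmod[of "z * w"] by (simp del: times_complex.sel)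
qed

lemma one_minus_mult_nz:
  assumes "norm (z::complex) < 1" "norm w < 1"
  shows "1 - z * w \<noteq> 0"
  using Re_one_minus_mult_pos[OF assms] by (metis less_irrefl zero_complex.sel(1))

lemma koebe_diff:
  assumes "z \<noteq> 1" "w \<noteq> 1"
  shows "koebe z - koebe w = (z - w) * (1 - z * w) / ((1 - z)\<^sup>2 * (1 - w)\<^sup>2)"
proof -
  have "koebe z - koebe w = (z * (1 - w)\<^sup>2 - w * (1 - z)\<^sup>2) / ((1 - z)\<^sup>2 * (1 - w)\<^sup>2)"
    using assms by (simp add: koebe_def diff_frac_eq)
  also have "z * (1 - w)\<^sup>2 - w * (1 - z)\<^sup>2 = (z - w) * (1 - z * w)"
    by (simp add: power2_eq_square algebra_simps)
  finally show ?thesis .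
qed

lemma koebe_has_field_derivative:
  assumes "z \<noteq> 1"
  shows "(koebe has_field_derivative (1 + z) / (1 - z) ^ 3) (at z)"
proof -
  have nz: "1 - z \<noteq> 0" using assms by simp
  have "(koebe has_field_derivative
      (1 * (1 - z)\<^sup>2 - z * (- 2 * (1 - z))) / ((1 - z)\<^sup>2 * (1 - z)\<^sup>2)) (at z)"
    unfolding koebe_def using nz by (auto intro!: derivative_eq_intros)
  also have "1 * (1 - z)\<^sup>2 - z * (- 2 * (1 - z)) = (1 + z) * (1 - z)"
    by (simp add: power2_eq_square algebra_simps)
  also have "(1 + z) * (1 - z) / ((1 - z)\<^sup>2 * (1 - z)\<^sup>2) = (1 + z) / (1 - z) ^ 3"
    using nz by (simp add: divide_simps power2_eq_square power3_eq_cube)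
  finally show ?thesis .
qed

lemma koebe_in_class_S: "koebe \<in> class_S"
proof -
  have "koebe holomorphic_on unit_disk"
    unfolding holomorphic_on_open[OF open_ball]
  proof
    fix z assume "z \<in> unit_disk"
    hence "z \<noteq> 1" by auto
    thus "\<exists>f'. (koebe has_field_derivative f') (at z)"
      using koebe_has_field_derivative by blast
  qed
  moreover have "inj_on koebe unit_disk"
  proof (rule inj_onI)
    fix z w assume zw: "z \<in> unit_disk" "w \<in> unit_disk" "koebe z = koebe w"
    hence "z \<noteq> 1" "w \<noteq> 1" "1 - z * w \<noteq> 0"
      using one_minus_mult_nz[of z w] by auto
    thus "z = w" using koebe_diff[of z w] zw by auto
  qed
  moreover have "deriv koebe 0 = 1"
    using DERIV_imp_deriv[OF koebe_has_field_derivative[of 0]] by simp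
  ultimately show ?thesis by (simp add: class_S_def koebe_def)
qed

lemma log_arg_koebe:
  assumes "z \<in> unit_disk" "w \<in> unit_disk"
  shows "log_arg koebe z w = 1 - z * w"
proof -
  have z1: "z \<noteq> 1" and w1: "w \<noteq> 1" using assms by auto
  have id: "id_over koebe u = (1 - u)\<^sup>2" if "u \<noteq> 1" for u
    using that by (simp add: id_over_def koebe_def)
  show ?thesis
  proof (cases "z = w")
    case True
    have "(1 + z) / (1 - z) ^ 3 * ((1 - z)\<^sup>2)\<^sup>2 = (1 + z) * (1 - z)"
      using z1 by (simp add: divide_simps power2_eq_square power3_eq_cube)
    thus ?thesis using True id[OF z1] DERIV_imp_deriv[OF koebe_has_field_derivative[OF z1]]
      by (simp add: log_arg_def algebra_simps)
  next
    case False
    thus ?thesis using z1 w1 by (simp add: log_arg_def id koebe_diff)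
  qed
qed

lemma Ln_is_log_branch_koebe: "is_log_branch koebe (\<lambda>z w. Ln (1 - z * w))"
  unfolding is_log_branch_def holomorphic2_on_def
proof (intro conjI ballI)
  fix x assume "x \<in> unit_disk \<times> unit_disk"
  then obtain z w where x: "x = (z, w)" "norm z < 1" "norm w < 1" by auto
  have "1 - z * w \<notin> \<real>\<^sub>\<le>\<^sub>0"
    using Re_one_minus_mult_pos[OF x(2,3)]
    by (auto simp: complex_nonpos_Reals_iff simp del: times_complex.sel)
  hence "(Ln has_derivative (*) (inverse (1 - z * w))) (at (1 - z * w))"
    using has_field_derivative_Ln[of "1 - z * w"] by (simp add: has_field_derivative_def)
  also have "(*) (inverse (1 - z * w)) = (\<lambda>h. h / (1 - z * w))"
    by (simp add: fun_eq_iff divide_inverse mult.commute)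
  finally have *: "(Ln has_derivative (\<lambda>h. h / (1 - z * w))) (at (1 - z * w))" .
  have "((\<lambda>y. 1 - fst y * snd y) has_derivative
      (\<lambda>d. - (z * snd d + fst d * w))) (at x within unit_disk \<times> unit_disk)"
    using x by (auto intro!: derivative_eq_intros)
  from has_derivative_compose[OF this, of Ln "\<lambda>h. h / (1 - z * w)"] *
  have "((\<lambda>y. Ln (1 - fst y * snd y)) has_derivative
      (\<lambda>d. - (z * snd d + fst d * w) / (1 - z * w))) (at x within unit_disk \<times> unit_disk)"
    using x by simp
  also have "(\<lambda>d. - (z * snd d + fst d * w) / (1 - z * w)) =
      (\<lambda>(h, k). (- w / (1 - z * w)) * h + (- z / (1 - z * w)) * k)"
    by (auto simp: fun_eq_iff add_divide_distrib diff_divide_distrib)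
  also have "(\<lambda>y. Ln (1 - fst y * snd y)) = (\<lambda>(z, w). Ln (1 - z * w))"
    by auto
  finally show "\<exists>a b. ((\<lambda>(z, w). Ln (1 - z * w)) has_derivative (\<lambda>(h, k). a * h + b * k))
      (at x within unit_disk \<times> unit_disk)"
    by blast
next
  fix z w assume "z \<in> unit_disk" "w \<in> unit_disk"
  thus "exp (Ln (1 - z * w)) = log_arg koebe z w"
    using one_minus_mult_nz[of z w] by (simp add: log_arg_koebe exp_Ln)
qed simp

lemma is_log_branch_continuous:
  assumes "is_log_branch f F"
  shows "continuous_on (unit_disk \<times> unit_disk) (\<lambda>(z, w). F z w)"
  using assms has_derivative_continuous
  unfolding is_log_branch_def holomorphic2_on_def continuous_on_eq_continuous_within by blast

text \<open>The exponential of the difference of two branches is \<open>1\<close>, so its values lie in a set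
  whose distinct points are at least \<open>2 \<pi>\<close> apart.\<close>

lemma is_log_branch_unique:
  assumes F: "is_log_branch f F" and H: "is_log_branch f H"
    and z: "z \<in> unit_disk" and w: "w \<in> unit_disk"
  shows "F z w = H z w"
proof -
  define D where "D = (\<lambda>x. F (fst x) (snd x) - H (fst x) (snd x))"
  have expD: "exp (D x) = 1" if "x \<in> unit_disk \<times> unit_disk" for x
  proof -
    have e: "exp (F (fst x) (snd x)) = exp (H (fst x) (snd x))"
      using F H that by (auto simp: is_log_branch_def)
    show ?thesis by (simp add: D_def exp_diff e)
  qed
  have "D constant_on unit_disk \<times> unit_disk"
  proof (rule continuous_discrete_range_constant)
    show "connected (unit_disk \<times> unit_disk)"
      by (intro convex_connected convex_Times convex_ball)
    show "continuous_on (unit_disk \<times> unit_disk) D"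
      using is_log_branch_continuous[OF F] is_log_branch_continuous[OF H]
      unfolding D_def case_prod_unfold by (intro continuous_intros)
    fix x assume x: "x \<in> unit_disk \<times> unit_disk"
    have "1 \<le> norm (D y - D x)" if y: "y \<in> unit_disk \<times> unit_disk" "D y \<noteq> D x" for y
    proof (rule ccontr)
      assume "\<not> 1 \<le> norm (D y - D x)"
      hence "\<bar>Im (D y) - Im (D x)\<bar> < 2 * pi"
        using abs_Im_le_cmod[of "D y - D x"] pi_gt3 by simp
      hence "D y = D x"
        using expD[OF x] expD[OF y(1)] by - (rule exp_complex_eqI, simp_all)
      with y(2) show False by contradiction
    qed
    thus "\<exists>e>0. \<forall>y. y \<in> unit_disk \<times> unit_disk \<and> D y \<noteq> D x \<longrightarrow> e \<le> norm (D y - D x)"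
      by (intro exI[of _ 1]) auto
  qed
  then obtain c where c: "\<And>x. x \<in> unit_disk \<times> unit_disk \<Longrightarrow> D x = c"
    unfolding constant_on_def by blast
  have "D (0, 0) = 0" using F H by (simp add: D_def is_log_branch_def)
  hence "D (z, w) = 0" using c[of "(0, 0)"] c[of "(z, w)"] z w by simp
  thus ?thesis by (simp add: D_def)
qed

lemma log_branch_koebe:
  assumes "z \<in> unit_disk" "w \<in> unit_disk"
  shows "log_branch koebe z w = Ln (1 - z * w)"
proof -
  have "is_log_branch koebe (log_branch koebe)"
    unfolding log_branch_def using someI[of "is_log_branch koebe", OF Ln_is_log_branch_koebe] .
  thus ?thesis using is_log_branch_unique[OF _ Ln_is_log_branch_koebe] assms by blast
qed

section \<open>The higher-order Schwarzian of the Koebe function\<close>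

lemma higher_deriv_eqI:
  fixes g :: "nat \<Rightarrow> 'a::real_normed_field \<Rightarrow> 'a"
  assumes "open S" "x \<in> S"
    and "\<And>x. x \<in> S \<Longrightarrow> f x = g 0 x"
    and d: "\<And>n x. x \<in> S \<Longrightarrow> (g n has_field_derivative g (Suc n) x) (at x)"
  shows "(deriv ^^ n) f x = g n x"
  using assms(2)
proof (induction n arbitrary: x)
  case 0
  thus ?case using assms(3) by simp
next
  case (Suc n)
  have "eventually (\<lambda>y. (deriv ^^ n) f y = g n y) (nhds x)"
    using eventually_nhds_in_open[OF assms(1) Suc.prems] Suc.IH by (auto elim: eventually_mono)
  hence "deriv ((deriv ^^ n) f) x = deriv (g n) x"
    by (intro deriv_cong_ev refl)
  also have "\<dots> = g (Suc n) x" using d[OF Suc.prems] by (rule DERIV_imp_deriv)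
  finally show ?case by simp
qed

lemma higher_deriv_monomial:
  "(deriv ^^ k) (\<lambda>z. z ^ n) (z::complex) = of_nat ((n choose k) * fact k) * z ^ (n - k)"
proof (rule higher_deriv_eqI[where S = UNIV])
  fix j and x :: complex
  have "(n - j) * (n choose j) = Suc j * (n choose Suc j)"
    by (simp only: binomial_absorb_comp binomial_absorption)
  hence coeff: "(n choose j) * fact j * (n - j) = (n choose Suc j) * fact (Suc j)"
    by (simp only: fact_Suc of_nat_id mult_ac)
  have "((\<lambda>z. of_nat ((n choose j) * fact j) * z ^ (n - j)) has_field_derivative
      of_nat ((n choose j) * fact j) * (of_nat (n - j) * x ^ (n - j - 1))) (at x)"
    by (rule derivative_eq_intros refl | simp)+
  also have "of_nat ((n choose j) * fact j) * (of_nat (n - j) * x ^ (n - j - 1)) =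
      of_nat ((n choose Suc j) * fact (Suc j)) * x ^ (n - Suc j)"
    unfolding coeff[symmetric] of_nat_mult by (simp add: mult.assoc)
  finally show "((\<lambda>z. of_nat ((n choose j) * fact j) * z ^ (n - j)) has_field_derivative
      of_nat ((n choose Suc j) * fact (Suc j)) * x ^ (n - Suc j)) (at x)" .
qed auto

lemma higher_deriv_geometric_power:
  fixes a z :: complex
  assumes "a * z \<noteq> 1"
  shows "(deriv ^^ n) (\<lambda>z. 1 / (1 - a * z) ^ Suc m) z =
    fact (m + n) / fact m * a ^ n / (1 - a * z) ^ (Suc m + n)"
proof (rule higher_deriv_eqI[where S = "{z. a * z \<noteq> 1}"])
  show "open {z. a * z \<noteq> 1}"
    by (intro open_Collect_neq continuous_intros)
next
  fix j and x :: complex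
  assume "x \<in> {z. a * z \<noteq> 1}"
  hence nz: "1 - a * x \<noteq> 0" by simp
  let ?C = "fact (m + j) / fact m * a ^ j :: complex"
  have "((\<lambda>z. (1 - a * z) ^ Suc (m + j)) has_field_derivative
      of_nat (Suc (m + j)) * (1 - a * x) ^ (m + j) * (- a)) (at x)"
    by (rule derivative_eq_intros refl | simp)+
  from DERIV_divide[OF DERIV_const[of ?C] this]
  have "((\<lambda>z. ?C / (1 - a * z) ^ (Suc m + j)) has_field_derivative
      ?C * (of_nat (Suc (m + j)) * (1 - a * x) ^ (m + j) * a) /
        ((1 - a * x) ^ (Suc m + j) * (1 - a * x) ^ (Suc m + j))) (at x)"
    using nz by simp
  also have "?C * (of_nat (Suc (m + j)) * (1 - a * x) ^ (m + j) * a) /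
        ((1 - a * x) ^ (Suc m + j) * (1 - a * x) ^ (Suc m + j)) =
      fact (m + Suc j) / fact m * a ^ Suc j / (1 - a * x) ^ (Suc m + Suc j)"
    using nz by (simp add: divide_simps)
  finally show "((\<lambda>z. ?C / (1 - a * z) ^ (Suc m + j)) has_field_derivative
      fact (m + Suc j) / fact m * a ^ Suc j / (1 - a * x) ^ (Suc m + Suc j)) (at x)" .
qed (use assms in auto)

lemma higher_deriv_Ln:
  assumes "z \<in> unit_disk" "w \<in> unit_disk"
  shows "(deriv ^^ Suc m) (\<lambda>w. Ln (1 - z * w)) w = - fact m * z ^ Suc m / (1 - z * w) ^ Suc m"
proof -
  have ev: "eventually (\<lambda>w. deriv (\<lambda>w. Ln (1 - z * w)) w = - z * (1 / (1 - z * w) ^ Suc 0)) (nhds w)"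
    using eventually_nhds_in_open[OF open_ball assms(2)]
  proof (rule eventually_mono)
    fix u assume u: "u \<in> unit_disk"
    have "1 - z * u \<notin> \<real>\<^sub>\<le>\<^sub>0"
      using Re_one_minus_mult_pos[of z u] u assms
      by (auto simp: complex_nonpos_Reals_iff simp del: times_complex.sel)
    hence "((\<lambda>w. Ln (1 - z * w)) has_field_derivative - z * (1 / (1 - z * u) ^ Suc 0)) (at u)"
      by (auto intro!: derivative_eq_intros simp: field_simps)
    thus "deriv (\<lambda>w. Ln (1 - z * w)) u = - z * (1 / (1 - z * u) ^ Suc 0)"
      by (rule DERIV_imp_deriv)
  qed
  have nz: "1 - z * u \<noteq> 0" if "u \<in> unit_disk" for u
    using one_minus_mult_nz[of z u] assms that by simp
  have "(deriv ^^ Suc m) (\<lambda>w. Ln (1 - z * w)) w = (deriv ^^ m) (deriv (\<lambda>w. Ln (1 - z * w))) w"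
    by (simp add: funpow_Suc_right del: funpow.simps)
  also have "\<dots> = (deriv ^^ m) (\<lambda>w. - z * (1 / (1 - z * w) ^ Suc 0)) w"
    using ev by (rule higher_deriv_cong_ev) simp
  also have "\<dots> = - z * (deriv ^^ m) (\<lambda>w. 1 / (1 - z * w) ^ Suc 0) w"
    using nz assms(2)
    by (intro higher_deriv_cmult[where A = unit_disk]) (auto intro!: holomorphic_intros)
  also have "(deriv ^^ m) (\<lambda>w. 1 / (1 - z * w) ^ Suc 0) w =
      fact m * z ^ m / (1 - z * w) ^ Suc m"
    using higher_deriv_geometric_power[of z w m 0] nz[OF assms(2)] by simp
  finally show ?thesis by simp
qed

text \<open>The factor \<open>(q choose k) * fact k\<close> comes from differentiating \<open>z^q\<close>, and
  \<open>fact (p + q - 1 - k)\<close> from the remaining \<open>p - k\<close> derivatives of \<open>(q - 1)! / (1 - z w)^q\<close>.\<close>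

definition koebe_coeff :: "nat \<Rightarrow> nat \<Rightarrow> nat \<Rightarrow> nat" where
  "koebe_coeff p q k = (p choose k) * (q choose k) * fact k * fact (p + q - 1 - k)"

lemma koebe_coeff_commute: "koebe_coeff p q k = koebe_coeff q p k"
  by (simp add: koebe_coeff_def add.commute)

lemma higher_schwarzian_koebe:
  assumes z: "z \<in> unit_disk" and q: "q > 0"
  shows "higher_schwarzian koebe p q z =
    - (\<Sum>k\<le>min p q. of_nat (koebe_coeff p q k) * z ^ ((p - k) + (q - k)) /
         (1 - z\<^sup>2) ^ (p + q - k))"
proof -
  obtain m where m: "q = Suc m" using q by (cases q) auto
  have nz: "1 - u * z \<noteq> 0" if "u \<in> unit_disk" for u
    using one_minus_mult_nz[of u z] z that by simp
  have inner: "(deriv ^^ q) (\<lambda>\<omega>. log_branch koebe \<zeta> \<omega>) z =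
      - fact m * (\<zeta> ^ q * (1 / (1 - z * \<zeta>) ^ q))" if "\<zeta> \<in> unit_disk" for \<zeta>
  proof -
    have "eventually (\<lambda>\<omega>. log_branch koebe \<zeta> \<omega> = Ln (1 - \<zeta> * \<omega>)) (nhds z)"
      using eventually_nhds_in_open[OF open_ball z] log_branch_koebe[OF that]
      by (auto elim: eventually_mono)
    hence "(deriv ^^ q) (\<lambda>\<omega>. log_branch koebe \<zeta> \<omega>) z = (deriv ^^ q) (\<lambda>\<omega>. Ln (1 - \<zeta> * \<omega>)) z"
      by (rule higher_deriv_cong_ev) simp
    thus ?thesis using higher_deriv_Ln[OF that z, of m] by (simp add: m mult.commute)
  qed
  have "higher_schwarzian koebe p q z =
      (deriv ^^ p) (\<lambda>\<zeta>. - fact m * (\<zeta> ^ q * (1 / (1 - z * \<zeta>) ^ q))) z"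
    unfolding higher_schwarzian_def G_deriv_def
    using eventually_nhds_in_open[OF open_ball z] inner
    by (intro higher_deriv_cong_ev refl) (auto elim: eventually_mono)
  also have "\<dots> = - fact m * (deriv ^^ p) (\<lambda>\<zeta>. \<zeta> ^ q * (1 / (1 - z * \<zeta>) ^ q)) z"
    using nz z by (intro higher_deriv_cmult[where A = unit_disk])
      (auto intro!: holomorphic_intros simp: mult.commute)
  also have "(deriv ^^ p) (\<lambda>\<zeta>. \<zeta> ^ q * (1 / (1 - z * \<zeta>) ^ q)) z =
      (\<Sum>k = 0..p. of_nat (p choose k) * (deriv ^^ k) (\<lambda>\<zeta>. \<zeta> ^ q) z *
        (deriv ^^ (p - k)) (\<lambda>\<zeta>. 1 / (1 - z * \<zeta>) ^ q) z)"
    using nz z by (intro higher_deriv_mult[where S = unit_disk])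
      (auto intro!: holomorphic_intros simp: mult.commute)
  also have "- fact m * \<dots> = - (\<Sum>k\<in>{0..p}. of_nat (koebe_coeff p q k) * z ^ ((p - k) + (q - k)) /
         (1 - z\<^sup>2) ^ (p + q - k))"
    unfolding sum_distrib_left sum_negf[symmetric]
  proof (rule sum.cong)
    fix k assume "k \<in> {0..p}"
    hence k: "m + (p - k) = p + q - 1 - k" "q + (p - k) = p + q - k" using m by auto
    have "(deriv ^^ (p - k)) (\<lambda>\<zeta>. 1 / (1 - z * \<zeta>) ^ q) z =
        fact (p + q - 1 - k) / fact m * z ^ (p - k) / (1 - z\<^sup>2) ^ (p + q - k)"
      using higher_deriv_geometric_power[of z z "p - k" m] nz[OF z] unfolding m[symmetric] k
      by (simp add: power2_eq_square)
    thus "- fact m * (of_nat (p choose k) * (deriv ^^ k) (\<lambda>\<zeta>. \<zeta> ^ q) z *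
        (deriv ^^ (p - k)) (\<lambda>\<zeta>. 1 / (1 - z * \<zeta>) ^ q) z) =
      - (of_nat (koebe_coeff p q k) * z ^ ((p - k) + (q - k)) / (1 - z\<^sup>2) ^ (p + q - k))"
      unfolding higher_deriv_monomial by (simp add: koebe_coeff_def power_add)
  qed simp
  \<comment> \<open>Cutting the sum at \<open>min p q\<close> makes the formula symmetric in \<open>p\<close> and \<open>q\<close>.\<close>
  also have "(\<Sum>k\<in>{0..p}. of_nat (koebe_coeff p q k) * z ^ ((p - k) + (q - k)) /
         (1 - z\<^sup>2) ^ (p + q - k)) =
      (\<Sum>k\<le>min p q. of_nat (koebe_coeff p q k) * z ^ ((p - k) + (q - k)) /
         (1 - z\<^sup>2) ^ (p + q - k))"
    by (rule sum.mono_neutral_right) (auto simp: koebe_coeff_def)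
  finally show ?thesis .
qed

section \<open>The weighted supremum\<close>

text \<open>This is the weighted modulus of the Schwarzian at a point \<open>x\<close> of \<open>[0, 1)\<close>, written
  as a polynomial so that it makes sense at the boundary point \<open>x = 1\<close>.\<close>

definition radial_weight :: "nat \<Rightarrow> nat \<Rightarrow> real \<Rightarrow> real" where
  "radial_weight p q x =
     (\<Sum>k\<le>min p q. real (koebe_coeff p q k) * x ^ ((p - k) + (q - k)) * (1 - x\<^sup>2) ^ k)"

lemma radial_weight_commute: "radial_weight p q x = radial_weight q p x"
  by (simp add: radial_weight_def koebe_coeff_commute[of p q] min.commute add.commute)

lemma radial_weight_1: "radial_weight p q 1 = fact (p + q - 1)"
  by (simp add: radial_weight_def koebe_coeff_def power_0_left if_distrib sum.delta cong: if_cong)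

text \<open>Enlarging \<open>q\<close> to \<open>p + q - 1\<close> in the second binomial coefficient makes the factorials collapse;
  \<open>p > 0\<close> is what makes this an enlargement.\<close>

lemma koebe_coeff_le:
  assumes "p > 0" "k \<le> q"
  shows "koebe_coeff p q k \<le> (p choose k) * fact (p + q - 1)"
proof -
  have k: "k \<le> p + q - 1" using assms by simp
  have "koebe_coeff p q k = (p choose k) * ((q choose k) * (fact k * fact (p + q - 1 - k)))"
    by (simp add: koebe_coeff_def)
  also have "\<dots> \<le> (p choose k) * ((p + q - 1 choose k) * (fact k * fact (p + q - 1 - k)))"
    using assms by (intro mult_left_mono mult_right_mono binomial_right_mono) auto
  also have "(p + q - 1 choose k) * (fact k * fact (p + q - 1 - k)) = fact (p + q - 1)"
    using binomial_fact_lemma[OF k] by (simp add: mult_ac)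
  finally show ?thesis .
qed

text \<open>The weight is symmetric in \<open>p\<close> and \<open>q\<close>, so let \<open>p \<le> q\<close>: then \<open>x^(q - k) \<le> x^(p - k)\<close>, and
  the remaining sum is the binomial expansion of \<open>((1 - x^2) + x^2)^p\<close>.\<close>

lemma radial_weight_le:
  assumes "p > 0" "q > 0" "0 \<le> x" "x \<le> 1"
  shows "radial_weight p q x \<le> fact (p + q - 1)"
proof -
  have x2: "x\<^sup>2 \<le> 1" using assms by (simp add: power_le_one)
  have main: "radial_weight p q x \<le> fact (p + q - 1)" if pq: "p \<le> q" "p > 0" for p q
  proof -
    have "radial_weight p q x \<le>
        (\<Sum>k\<le>p. real ((p choose k) * fact (p + q - 1)) * (x\<^sup>2) ^ (p - k) * (1 - x\<^sup>2) ^ k)"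
      unfolding radial_weight_def min_absorb1[OF pq(1)]
    proof (intro sum_mono mult_mono)
      fix k assume "k \<in> {..p}"
      thus "real (koebe_coeff p q k) \<le> real ((p choose k) * fact (p + q - 1))"
        using koebe_coeff_le[of p k q] pq by (simp only: of_nat_le_iff) simp
      show "x ^ ((p - k) + (q - k)) \<le> (x\<^sup>2) ^ (p - k)"
        unfolding power_mult[symmetric] using assms pq by (intro power_decreasing) auto
    qed (use assms x2 in auto)
    also have "\<dots> = fact (p + q - 1) *
        (\<Sum>k\<le>p. of_nat (p choose k) * (1 - x\<^sup>2) ^ k * (x\<^sup>2) ^ (p - k))"
      by (simp add: sum_distrib_left mult_ac)
    also have "\<dots> = fact (p + q - 1) * ((1 - x\<^sup>2) + x\<^sup>2) ^ p"
      by (simp only: binomial_ring)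
    finally show ?thesis by simp
  qed
  show ?thesis
  proof (cases "p \<le> q")
    case True
    thus ?thesis using main assms by simp
  next
    case False
    thus ?thesis using main[of q p] assms by (simp add: radial_weight_commute[of p q] add.commute)
  qed
qed

text \<open>In the \<open>k\<close>-th summand the denominator absorbs \<open>p + q - k\<close> of the \<open>p + q\<close> factors
  \<open>1 - \<bar>z\<bar>^2\<close> of the weight, which leaves \<open>(1 - \<bar>z\<bar>^2)^k\<close>.\<close>

lemma norm_schwarzian_koebe_le:
  assumes z: "z \<in> unit_disk" and "q > 0"
  shows "norm (higher_schwarzian koebe p q z) * (1 - (norm z)\<^sup>2) ^ (p + q) \<le>
    radial_weight p q (norm z)"
proof -
  let ?r = "norm z" and ?c = "\<lambda>k. real (koebe_coeff p q k)"
  have r: "0 < 1 - ?r\<^sup>2" using z by (simp add: abs_square_less_1)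
  have den: "1 - ?r\<^sup>2 \<le> norm (1 - z\<^sup>2)"
    using norm_triangle_ineq2[of 1 "z\<^sup>2"] by (simp add: norm_power)
  have "norm (higher_schwarzian koebe p q z) * (1 - ?r\<^sup>2) ^ (p + q) \<le>
      (\<Sum>k\<le>min p q. ?c k * ?r ^ ((p - k) + (q - k)) / norm (1 - z\<^sup>2) ^ (p + q - k)) *
        (1 - ?r\<^sup>2) ^ (p + q)"
    unfolding higher_schwarzian_koebe[OF z \<open>q > 0\<close>] norm_minus_cancel using r
    by (intro mult_right_mono order.trans[OF norm_sum])
       (auto simp: norm_mult norm_divide norm_power)
  also have "\<dots> \<le> radial_weight p q ?r"
    unfolding radial_weight_def sum_distrib_right
  proof (rule sum_mono)
    fix k assume "k \<in> {..min p q}"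
    hence split: "(1 - ?r\<^sup>2) ^ (p + q) = (1 - ?r\<^sup>2) ^ (p + q - k) * (1 - ?r\<^sup>2) ^ k"
      by (simp flip: power_add)
    have "(1 - ?r\<^sup>2) ^ (p + q - k) / norm (1 - z\<^sup>2) ^ (p + q - k) \<le> 1"
      using r den by (intro divide_le_eq_1_pos[THEN iffD2] power_mono zero_less_power) auto
    hence "?c k * ?r ^ ((p - k) + (q - k)) * (1 - ?r\<^sup>2) ^ k *
        ((1 - ?r\<^sup>2) ^ (p + q - k) / norm (1 - z\<^sup>2) ^ (p + q - k)) \<le>
        ?c k * ?r ^ ((p - k) + (q - k)) * (1 - ?r\<^sup>2) ^ k"
      using r by (intro mult_left_le) auto
    thus "?c k * ?r ^ ((p - k) + (q - k)) / norm (1 - z\<^sup>2) ^ (p + q - k) * (1 - ?r\<^sup>2) ^ (p + q) \<le>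
        ?c k * ?r ^ ((p - k) + (q - k)) * (1 - ?r\<^sup>2) ^ k"
      unfolding split by (simp add: mult_ac)
  qed
  finally show ?thesis .
qed

lemma norm_schwarzian_koebe_real:
  assumes x: "0 \<le> x" "x < 1" and "q > 0"
  shows "norm (higher_schwarzian koebe p q (of_real x)) * (1 - x\<^sup>2) ^ (p + q) =
    radial_weight p q x"
proof -
  let ?s = "\<lambda>k. real (koebe_coeff p q k) * x ^ ((p - k) + (q - k)) / (1 - x\<^sup>2) ^ (p + q - k)"
  have r: "0 < 1 - x\<^sup>2" using x by (simp add: abs_square_less_1)
  have "higher_schwarzian koebe p q (of_real x) = - of_real (\<Sum>k\<le>min p q. ?s k)"
    using higher_schwarzian_koebe[of "of_real x" q p] x \<open>q > 0\<close> by simp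
  hence "norm (higher_schwarzian koebe p q (of_real x)) = (\<Sum>k\<le>min p q. ?s k)"
    using r x by (simp only: norm_minus_cancel norm_of_real) (auto intro!: abs_of_nonneg sum_nonneg)
  also have "\<dots> * (1 - x\<^sup>2) ^ (p + q) = radial_weight p q x"
    unfolding radial_weight_def sum_distrib_right
  proof (rule sum.cong)
    fix k assume "k \<in> {..min p q}"
    hence split: "(1 - x\<^sup>2) ^ (p + q) = (1 - x\<^sup>2) ^ (p + q - k) * (1 - x\<^sup>2) ^ k"
      by (simp flip: power_add)
    show "?s k * (1 - x\<^sup>2) ^ (p + q) =
        real (koebe_coeff p q k) * x ^ ((p - k) + (q - k)) * (1 - x\<^sup>2) ^ k"
      unfolding split using r by simp
  qed simp
  finally show ?thesis .
qed

text \<open>The supremum is approached along the positive real axis, where the weighted modulus equals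
  \<open>radial_weight\<close>; it need not be attained inside the disk.\<close>

theorem B_norm_schwarzian_koebe:
  assumes "p > 0" "q > 0"
  shows "B_norm (real (p + q)) (higher_schwarzian koebe p q) = ereal (fact (p + q - 1))"
proof -
  let ?g = "\<lambda>z. norm (higher_schwarzian koebe p q z) * (1 - (norm z)\<^sup>2) ^ (p + q)"
  have "0 < 1 - (norm z)\<^sup>2" if "z \<in> unit_disk" for z :: complex
    using that by (simp add: abs_square_less_1)
  hence B: "B_norm (real (p + q)) (higher_schwarzian koebe p q) = (SUP z\<in>unit_disk. ereal (?g z))"
    unfolding B_norm_def by (intro SUP_cong refl) (simp only: powr_realpow)
  show ?thesis
  proof (rule antisym)
    show "B_norm (real (p + q)) (higher_schwarzian koebe p q) \<le> ereal (fact (p + q - 1))"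
      unfolding B
    proof (rule SUP_least)
      fix z :: complex assume z: "z \<in> unit_disk"
      have "?g z \<le> radial_weight p q (norm z)"
        using norm_schwarzian_koebe_le[OF z \<open>q > 0\<close>] .
      also have "\<dots> \<le> fact (p + q - 1)"
        using assms z by (intro radial_weight_le) auto
      finally show "ereal (?g z) \<le> ereal (fact (p + q - 1))" by simp
    qed
  next
    have "isCont (radial_weight p q) 1"
      unfolding radial_weight_def by (intro continuous_intros)
    hence "(radial_weight p q \<longlongrightarrow> fact (p + q - 1)) (at_left 1)"
      unfolding radial_weight_1[symmetric] isCont_def by (rule filterlim_mono) (simp_all add: at_le)
    hence lim: "((\<lambda>x. ereal (radial_weight p q x)) \<longlongrightarrow> ereal (fact (p + q - 1))) (at_left 1)"
      by (rule tendsto_ereal)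
    have "eventually (\<lambda>x::real. x \<in> {0<..<1}) (at_left 1)"
      by (rule eventually_at_left_real) simp
    hence "eventually (\<lambda>x. ereal (radial_weight p q x) \<le>
        B_norm (real (p + q)) (higher_schwarzian koebe p q)) (at_left 1)"
    proof (rule eventually_mono)
      fix x :: real assume x: "x \<in> {0<..<1}"
      have "ereal (?g (of_real x)) \<le> B_norm (real (p + q)) (higher_schwarzian koebe p q)"
        unfolding B using x by (intro SUP_upper) simp
      thus "ereal (radial_weight p q x) \<le> B_norm (real (p + q)) (higher_schwarzian koebe p q)"
        using norm_schwarzian_koebe_real[of x q p] x \<open>q > 0\<close> by simp
    qed
    thus "ereal (fact (p + q - 1)) \<le> B_norm (real (p + q)) (higher_schwarzian koebe p q)"
      by (intro tendsto_upperbound[OF lim]) simp_all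
  qed
qed

theorem mainTheorem2:
  fixes p q :: nat
  assumes "p > 0" and "q > 0"
  shows "B_norm (real (p + q)) (higher_schwarzian koebe p q) = ereal (fact (p + q - 1)) \<and>
    (p = q \<longrightarrow>
       koebe \<in> class_S \<and>
       B_norm (real (p + q)) (higher_schwarzian koebe p q)
         = ereal (sqrt (fact (2 * p - 1) * fact (2 * q - 1))) \<and>
       B_norm (real (2 * p)) (higher_schwarzian koebe p p) = ereal (fact (2 * p - 1)))"
proof (intro conjI impI)
  show B: "B_norm (real (p + q)) (higher_schwarzian koebe p q) = ereal (fact (p + q - 1))"
    using B_norm_schwarzian_koebe[OF assms] .
  show "koebe \<in> class_S" by (rule koebe_in_class_S)
  assume pq: "p = q"
  show "B_norm (real (2 * p)) (higher_schwarzian koebe p p) = ereal (fact (2 * p - 1))"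
    using B unfolding pq mult_2 .
  show "B_norm (real (p + q)) (higher_schwarzian koebe p q) =
      ereal (sqrt (fact (2 * p - 1) * fact (2 * q - 1)))"
    using B unfolding pq mult_2 by (simp only: real_sqrt_abs2 abs_of_nonneg[OF fact_ge_zero])
qed

end
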